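(* Let $T$ be a tree with at least one edge. For each edge $e$ of $T$, let $T_1^e$ and $T_2^e$ be the two connected components of $T \setminus e$, and let \[k := \min_{e \in E(T)} \max\big(\operatorname{cd}(T_1^e), \operatorname{cd}(T_2^e)\big).\] If $k < \operatorname{cd}(T)$, then for every integer $n \ge k$ there exists a $(Q_n,T)$-saturated subgraph of $Q_n$ with exactly $k \cdot 2^{n-1}$ edges.
   Context: $Q_n$ is the $n$-dimensional hypercube: vertex set $\{0,1\}^n$, two vertices adjacent iff they differ in exactly one coordinate. A subgraph $H'$ of $Q_n$ is $(Q_n,T)$-saturated if $H'$ contains no subgraph isomorphic to $T$, but adding any edge of $Q_n$ not in $H'$ creates a subgraph isomorphic to $T$. The cubical dimension $\operatorname{cd}(T)$ of a tree $T$ is the smallest positive integer $d$ such that $T$ is isomorphic to a subgraph of $Q_d$ (for a single-vertex tree we take this to be the smallest such positive integer as well). *)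

theory Defs
  imports Main
begin

record 'a graph =
  verts :: "'a set"
  edges :: "'a set set"

definition simple_graph :: "'a graph \<Rightarrow> bool" where
  "simple_graph G \<longleftrightarrow> (\<forall>e \<in> edges G. e \<subseteq> verts G \<and> card e = 2)"

definition subgraph_of :: "'a graph \<Rightarrow> 'a graph \<Rightarrow> bool" where
  "subgraph_of S G \<longleftrightarrow> simple_graph S \<and> verts S \<subseteq> verts G \<and> edges S \<subseteq> edges G"

definition graph_isomorphic :: "'a graph \<Rightarrow> 'b graph \<Rightarrow> bool" where
  "graph_isomorphic G H \<longleftrightarrow>
    (\<exists>f. bij_betw f (verts G) (verts H) \<and>
      (\<forall>u \<in> verts G. \<forall>v \<in> verts G. {u, v} \<in> edges G \<longleftrightarrow> {f u, f v} \<in> edges H))"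

definition contains_copy :: "'a graph \<Rightarrow> 'b graph \<Rightarrow> bool" where
  "contains_copy G T \<longleftrightarrow> (\<exists>S. subgraph_of S G \<and> graph_isomorphic T S)"

definition reachable :: "'a graph \<Rightarrow> 'a \<Rightarrow> 'a \<Rightarrow> bool" where
  "reachable G = (\<lambda>u v. {u, v} \<in> edges G)\<^sup>*\<^sup>*"

definition graph_connected :: "'a graph \<Rightarrow> bool" where
  "graph_connected G \<longleftrightarrow>
    verts G \<noteq> {} \<and> (\<forall>u \<in> verts G. \<forall>v \<in> verts G. reachable G u v)"

text \<open>A cycle is the list of its distinct vertices in cyclic order; the first vertex is not
  repeated at the end.\<close>

definition is_cycle :: "'a graph \<Rightarrow> 'a list \<Rightarrow> bool" where
  "is_cycle G c \<longleftrightarrow>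
    length c \<ge> 3 \<and> distinct c \<and>
    (\<forall>i < length c. {c ! i, c ! (Suc i mod length c)} \<in> edges G)"

definition is_tree :: "'a graph \<Rightarrow> bool" where
  "is_tree T \<longleftrightarrow>
    simple_graph T \<and> finite (verts T) \<and> graph_connected T \<and> (\<nexists>c. is_cycle T c)"

definition induced_subgraph :: "'a graph \<Rightarrow> 'a set \<Rightarrow> 'a graph" where
  "induced_subgraph G A = \<lparr>verts = A, edges = {e \<in> edges G. e \<subseteq> A}\<rparr>"

definition components :: "'a graph \<Rightarrow> 'a graph set" where
  "components G =
    (\<lambda>u. induced_subgraph G {v \<in> verts G. reachable G u v}) ` verts G"

definition delete_edge :: "'a graph \<Rightarrow> 'a set \<Rightarrow> 'a graph" where
  "delete_edge G e = \<lparr>verts = verts G, edges = edges G - {e}\<rparr>"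

text \<open>Since subgraphs need not be spanning, adding an edge also adds its endpoints.\<close>

definition add_edge :: "'a graph \<Rightarrow> 'a set \<Rightarrow> 'a graph" where
  "add_edge G e = \<lparr>verts = verts G \<union> e, edges = insert e (edges G)\<rparr>"

definition hypercube :: "nat \<Rightarrow> bool list graph" where
  "hypercube n =
    \<lparr>verts = {x. length x = n},
     edges = {{x, y} | x y. length x = n \<and> length y = n \<and>
                card {i. i < n \<and> x ! i \<noteq> y ! i} = 1}\<rparr>"

text \<open>For a graph that embeds in no hypercube, the value of \<open>LEAST\<close> is meaningless. Every
  finite tree embeds in some hypercube.\<close>

definition cubical_dim :: "'a graph \<Rightarrow> nat" where
  "cubical_dim T = (LEAST d. 0 < d \<and> contains_copy (hypercube d) T)"

definition saturated :: "'a graph \<Rightarrow> 'b graph \<Rightarrow> 'a graph \<Rightarrow> bool" where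
  "saturated G T H \<longleftrightarrow>
    subgraph_of H G \<and> \<not> contains_copy H T \<and>
    (\<forall>e \<in> edges G - edges H. contains_copy (add_edge H e) T)"

text \<open>For an edge \<open>e\<close> of a tree \<open>T\<close>, the set \<open>components (delete_edge T e)\<close> consists of the two
  components on either side of \<open>e\<close>, so the inner \<open>Max\<close> is the maximum of two numbers.\<close>

definition edge_split_dim :: "'a graph \<Rightarrow> nat" where
  "edge_split_dim T =
    Min ((\<lambda>e. Max (cubical_dim ` components (delete_edge T e))) ` edges T)"

end

theory Submission
  imports Defs
begin

text \<open>Let \<open>H\<close> consist of the edges of \<open>Q_n\<close> in the first \<open>k\<close> directions, so that \<open>H\<close> is a disjoint
  union of copies of \<open>Q_k\<close>. A copy of the connected graph \<open>T\<close> in \<open>H\<close> would lie in one of them,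
  which \<open>k < cd(T)\<close> forbids. A further edge of \<open>Q_n\<close> joins corresponding vertices of two copies
  of \<open>Q_k\<close>. Splitting \<open>T\<close> at an optimal edge, each half embeds in one of these two copies, and since
  \<open>Q_k\<close> is vertex-transitive the ends of the split edge can be placed at the ends of the new one.
  The same gluing shows by induction that every finite forest embeds in some hypercube.\<close>

section \<open>Copies of a graph as injective edge-preserving maps\<close>

text \<open>Embeddings need not be induced: non-edges of \<open>G\<close> may become edges of
  \<open>K\<close>. Maps can be padded, translated and glued directly, which is awkward with
  subgraphs up to isomorphism.\<close>

definition is_embedding :: "('a \<Rightarrow> 'b) \<Rightarrow> 'a graph \<Rightarrow> 'b graph \<Rightarrow> bool" where
  "is_embedding f G K \<longleftrightarrow> inj_on f (verts G) \<and> f ` verts G \<subseteq> verts K \<and>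
    (\<forall>u v. {u, v} \<in> edges G \<longrightarrow> {f u, f v} \<in> edges K)"

lemma simple_graph_edgeD:
  assumes "simple_graph G" "{u, v} \<in> edges G"
  shows "u \<in> verts G" "v \<in> verts G" "u \<noteq> v"
  using assms by (auto simp: simple_graph_def dest!: bspec)

lemma simple_graph_edge_cases:
  assumes "simple_graph G" "e \<in> edges G"
  obtains u v where "e = {u, v}" "u \<noteq> v" "u \<in> verts G" "v \<in> verts G"
proof -
  have "card e = 2" "e \<subseteq> verts G"
    using assms by (auto simp: simple_graph_def)
  then show ?thesis
    using that by (auto simp: card_2_iff)
qed

text \<open>\<open>graph_isomorphic\<close> asks for an equivalence on edges, so the copy built from
  \<open>f\<close> has only the images of edges of \<open>T\<close> as edges, not all edges of
  \<open>K\<close> between image vertices.\<close>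

lemma contains_copy_iff_embedding:
  assumes "simple_graph T"
  shows "contains_copy K T \<longleftrightarrow> (\<exists>f. is_embedding f T K)"
proof
  assume "contains_copy K T"
  then obtain S f where S: "subgraph_of S K" and f: "bij_betw f (verts T) (verts S)"
    and e: "\<forall>u \<in> verts T. \<forall>v \<in> verts T. {u, v} \<in> edges T \<longleftrightarrow> {f u, f v} \<in> edges S"
    unfolding contains_copy_def graph_isomorphic_def by blast
  have "{f u, f v} \<in> edges K" if "{u, v} \<in> edges T" for u v
    using S e that simple_graph_edgeD[OF assms that] unfolding subgraph_of_def by blast
  then have "is_embedding f T K"
    using S f by (auto simp: is_embedding_def subgraph_of_def bij_betw_def)
  then show "\<exists>f. is_embedding f T K" by blast
next
  assume "\<exists>f. is_embedding f T K"
  then obtain f where f: "inj_on f (verts T)" "f ` verts T \<subseteq> verts K"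
    and e: "\<And>u v. {u, v} \<in> edges T \<Longrightarrow> {f u, f v} \<in> edges K"
    unfolding is_embedding_def by blast
  define S where "S = \<lparr>verts = f ` verts T, edges = (`) f ` edges T\<rparr>"
  have sub: "d \<subseteq> verts T" if "d \<in> edges T" for d
    using that assms by (auto simp: simple_graph_def)
  have "simple_graph S"
    unfolding simple_graph_def
  proof
    fix d assume "d \<in> edges S"
    then obtain d' where d': "d' \<in> edges T" "d = f ` d'"
      by (auto simp: S_def)
    have "card d = card d'"
      unfolding d'(2) using f(1) sub[OF d'(1)] by (meson card_image inj_on_subset)
    then show "d \<subseteq> verts S \<and> card d = 2"
      using d' assms sub[OF d'(1)] by (auto simp: S_def simple_graph_def)
  qed
  moreover have "edges S \<subseteq> edges K"
  proof
    fix d assume "d \<in> edges S"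
    then obtain d' where d': "d' \<in> edges T" "d = f ` d'"
      by (auto simp: S_def)
    with e show "d \<in> edges K"
      using simple_graph_edge_cases[OF assms d'(1)] by (metis image_empty image_insert)
  qed
  ultimately have "subgraph_of S K"
    using f by (auto simp: subgraph_of_def S_def)
  moreover have "{u, v} \<in> edges T \<longleftrightarrow> {f u, f v} \<in> edges S"
    if "u \<in> verts T" "v \<in> verts T" for u v
  proof
    assume "{f u, f v} \<in> edges S"
    then obtain d where d: "d \<in> edges T" "f ` {u, v} = f ` d"
      by (auto simp: S_def)
    then have "{u, v} = d"
      using f(1) sub[OF d(1)] that
      by (metis inj_on_image_eq_iff empty_subsetI insert_subset)
    with d show "{u, v} \<in> edges T" by simp
  qed (auto simp: S_def intro: rev_image_eqI)
  then have "graph_isomorphic T S"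
    unfolding graph_isomorphic_def using f(1)
    by (intro exI[of _ f]) (auto simp: S_def bij_betw_def)
  ultimately show "contains_copy K T"
    unfolding contains_copy_def by blast
qed


section \<open>Bridges\<close>

lemma reachable_mono:
  assumes "reachable G u v" "edges G \<subseteq> edges K"
  shows "reachable K u v"
  using assms rtranclp_mono[of "\<lambda>u v. {u, v} \<in> edges G" "\<lambda>u v. {u, v} \<in> edges K"]
  by (auto simp: reachable_def le_fun_def)

lemma reachable_refl: "reachable G u u"
  by (simp add: reachable_def)

lemma reachable_step: "reachable G u v \<Longrightarrow> {v, w} \<in> edges G \<Longrightarrow> reachable G u w"
  unfolding reachable_def by (rule rtranclp.rtrancl_into_rtrancl)

lemma reachable_sym: "reachable G u v \<Longrightarrow> reachable G v u"
  unfolding reachable_def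
  by (induction rule: rtranclp_induct)
    (auto intro: converse_rtranclp_into_rtranclp[rotated] simp: insert_commute)

lemma reachable_trans: "reachable G u v \<Longrightarrow> reachable G v w \<Longrightarrow> reachable G u w"
  unfolding reachable_def by (rule rtranclp_trans)

text \<open>A path is extended at its front. If the new vertex already occurs on it, the closed
  detour is cut out by keeping only the suffix that starts there.\<close>

lemma rtranclp_distinct_path:
  assumes "R\<^sup>*\<^sup>* u v"
  obtains p where "p \<noteq> []" "hd p = u" "last p = v" "distinct p" "successively R p"
proof -
  from assms have "\<exists>p. p \<noteq> [] \<and> hd p = u \<and> last p = v \<and> distinct p \<and> successively R p"
  proof (induction rule: converse_rtranclp_induct)
    case base
    show ?case by (rule exI[of _ "[v]"]) simp
  next
    case (step x y)
    then obtain p where p: "p \<noteq> []" "hd p = y" "last p = v" "distinct p" "successively R p"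
      by blast
    show ?case
    proof (cases "x \<in> set p")
      case True
      then obtain xs ys where "p = xs @ x # ys"
        by (meson split_list)
      with p show ?thesis
        by (intro exI[of _ "x # ys"]) (auto simp: successively_append_iff)
    next
      case False
      with p step.hyps(1) show ?thesis
        by (intro exI[of _ "x # p"]) (auto simp: successively_Cons)
    qed
  qed
  with that show ?thesis by blast
qed

text \<open>Acyclicity phrased as "every edge is a bridge". Gluing uses exactly this form, and
  disconnected graphs are allowed, so an induction may delete edges.\<close>

definition forest :: "'a graph \<Rightarrow> bool" where
  "forest G \<longleftrightarrow> simple_graph G \<and>
    (\<forall>u v. {u, v} \<in> edges G \<longrightarrow> \<not> reachable (delete_edge G {u, v}) u v)"

text \<open>If an edge were no bridge, a distinct path joining its ends without it would close up to
  a cycle through it.\<close>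

lemma acyclic_imp_forest:
  assumes simple: "simple_graph G" and acyclic: "\<nexists>c. is_cycle G c"
  shows "forest G"
  unfolding forest_def
proof (intro conjI allI impI notI simple)
  fix u v
  assume uv: "{u, v} \<in> edges G" and reach: "reachable (delete_edge G {u, v}) u v"
  from reach obtain p where p: "p \<noteq> []" "hd p = u" "last p = v" "distinct p"
    and succ: "successively (\<lambda>a b. {a, b} \<in> edges (delete_edge G {u, v})) p"
    unfolding reachable_def by (rule rtranclp_distinct_path)
  have path: "{p ! i, p ! Suc i} \<in> edges G - {{u, v}}" if "Suc i < length p" for i
    using succ that by (auto simp: successively_conv_nth delete_edge_def)
  have u: "p ! 0 = u" and v: "p ! (length p - 1) = v"
    using p by (auto simp: hd_conv_nth last_conv_nth)
  have "length p \<noteq> 0" "length p \<noteq> 1"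
    using p u v simple_graph_edgeD(3)[OF simple uv] by auto
  \<comment> \<open>A path on two vertices would be the deleted edge itself.\<close>
  moreover have "length p \<noteq> 2"
    using path[of 0] u v by auto
  ultimately have len: "length p \<ge> 3" by linarith
  have "{p ! i, p ! (Suc i mod length p)} \<in> edges G" if "i < length p" for i
  proof (cases "Suc i < length p")
    case True
    with path show ?thesis by simp
  next
    \<comment> \<open>At the last index the successor wraps around to 0, and the closing edge is
      \<open>{u, v}\<close>.\<close>
    case False
    with that have "Suc i = length p" by simp
    with u v uv show ?thesis
      by (metis diff_Suc_1 insert_commute mod_self)
  qed
  with len p have "is_cycle G p"
    by (simp add: is_cycle_def)
  with acyclic show False by blast
qed

text \<open>Bridges remain bridges when edges disappear, since reachability is monotone in the edge
  set.\<close>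

lemma forest_subgraph:
  assumes "forest G" "simple_graph S" "edges S \<subseteq> edges G"
  shows "forest S"
  unfolding forest_def
proof (intro conjI allI impI assms(2))
  fix u v assume "{u, v} \<in> edges S"
  then have "\<not> reachable (delete_edge G {u, v}) u v"
    using assms by (auto simp: forest_def)
  moreover have "edges (delete_edge S {u, v}) \<subseteq> edges (delete_edge G {u, v})"
    using assms(3) by (auto simp: delete_edge_def)
  ultimately show "\<not> reachable (delete_edge S {u, v}) u v"
    by (blast dest: reachable_mono)
qed

lemma simple_graph_delete_edge: "simple_graph G \<Longrightarrow> simple_graph (delete_edge G e)"
  by (auto simp: simple_graph_def delete_edge_def)

lemma simple_graph_induced: "simple_graph G \<Longrightarrow> simple_graph (induced_subgraph G A)"
  by (auto simp: simple_graph_def induced_subgraph_def)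

text \<open>Follow a walk from \<open>u\<close>: whenever it uses the deleted edge it arrives at
  \<open>u\<close> or \<open>v\<close>, and the count restarts there. Hence deleting an edge of a
  connected graph leaves at most two components.\<close>

lemma reachable_delete_edge_cases:
  assumes "reachable G u z"
  shows "reachable (delete_edge G {u, v}) u z \<or> reachable (delete_edge G {u, v}) v z"
  using assms unfolding reachable_def[of G]
proof (induction rule: rtranclp_induct)
  case base
  show ?case by (simp add: reachable_refl)
next
  case (step y z)
  show ?case
  proof (cases "{y, z} = {u, v}")
    case True
    then have "z = u \<or> z = v" by auto
    then show ?thesis by (auto simp: reachable_refl)
  next
    case False
    with step.hyps(2) have "{y, z} \<in> edges (delete_edge G {u, v})"
      by (simp add: delete_edge_def)
    with step.IH show ?thesis
      by (blast intro: reachable_step)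
  qed
qed

lemma embedding_restrict:
  assumes "is_embedding f G K" "A \<subseteq> verts G"
  shows "is_embedding f (induced_subgraph G A) K"
  using assms unfolding is_embedding_def induced_subgraph_def
  by (auto intro: inj_on_subset)


section \<open>Hypercubes\<close>

lemma verts_hypercube [simp]: "x \<in> verts (hypercube n) \<longleftrightarrow> length x = n"
  by (simp add: hypercube_def)

lemma hypercube_edge_iff:
  "{x, y} \<in> edges (hypercube n) \<longleftrightarrow>
    length x = n \<and> length y = n \<and> (\<exists>!i. i < n \<and> x ! i \<noteq> y ! i)"
proof -
  have *: "card {i. P i} = 1 \<longleftrightarrow> (\<exists>!i. P i)" for P :: "nat \<Rightarrow> bool"
    by (simp add: card_1_singleton_iff set_eq_iff) metis
  define D where "D x y = card {i. i < n \<and> x ! i \<noteq> y ! i}" for x y :: "bool list"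
  \<comment> \<open>An unordered pair can match the set comprehension in either order, so the count
    of differing positions must be symmetric.\<close>
  have sym: "D x y = D y x"
    unfolding D_def by (rule arg_cong[of _ _ card]) auto
  have "{x, y} \<in> edges (hypercube n) \<longleftrightarrow>
    (\<exists>a b. {x, y} = {a, b} \<and> length a = n \<and> length b = n \<and> D a b = 1)"
    by (simp add: hypercube_def D_def)
  also have "\<dots> \<longleftrightarrow> length x = n \<and> length y = n \<and> D x y = 1"
    unfolding doubleton_eq_iff using sym by auto
  finally have "{x, y} \<in> edges (hypercube n) \<longleftrightarrow>
    length x = n \<and> length y = n \<and> card {i. i < n \<and> x ! i \<noteq> y ! i} = 1"
    unfolding D_def .
  then show ?thesis unfolding * .
qed

lemma simple_graph_hypercube: "simple_graph (hypercube n)"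
  unfolding simple_graph_def
proof
  fix e assume e: "e \<in> edges (hypercube n)"
  then obtain x y where xy: "e = {x, y}"
    by (auto simp: hypercube_def)
  with e have "length x = n" "length y = n" "x \<noteq> y"
    by (auto simp: hypercube_edge_iff)
  with xy show "e \<subseteq> verts (hypercube n) \<and> card e = 2"
    by auto
qed

lemma hypercube_edge_append:
  assumes "{x, y} \<in> edges (hypercube d)" "length s = m"
  shows "{x @ s, y @ s} \<in> edges (hypercube (d + m))"
proof -
  have len: "length x = d" "length y = d" and ex: "\<exists>!i. i < d \<and> x ! i \<noteq> y ! i"
    using assms by (auto simp: hypercube_edge_iff)
  have "i < d + m \<and> (x @ s) ! i \<noteq> (y @ s) ! i \<longleftrightarrow> i < d \<and> x ! i \<noteq> y ! i" for i
    using len assms(2) by (auto simp: nth_append)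
  with len ex assms(2) show ?thesis
    by (simp add: hypercube_edge_iff)
qed

lemma hypercube_edge_take:
  assumes "{x, y} \<in> edges (hypercube n)" "drop k x = drop k y" "k \<le> n"
  shows "{take k x, take k y} \<in> edges (hypercube k)"
proof -
  have len: "length x = n" "length y = n" and ex: "\<exists>!i. i < n \<and> x ! i \<noteq> y ! i"
    using assms by (auto simp: hypercube_edge_iff)
  have tail: "x ! i = y ! i" if "k \<le> i" "i < n" for i
    using that len nth_drop[of k x "i - k"] nth_drop[of k y "i - k"] assms(2,3) by simp
  have "i < k \<and> take k x ! i \<noteq> take k y ! i \<longleftrightarrow> i < n \<and> x ! i \<noteq> y ! i" for i
    using assms(3) tail[of i] by (cases "i < k") auto
  with len ex assms(3) show ?thesis
    by (simp add: hypercube_edge_iff)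
qed

text \<open>The single differing coordinate lies in the tail, so the edge joins corresponding
  vertices of two copies of \<open>Q_k\<close>.\<close>

lemma hypercube_edge_take_eq:
  assumes "{x, y} \<in> edges (hypercube n)" "drop k x \<noteq> drop k y" "k \<le> n"
  shows "take k x = take k y"
proof -
  have len: "length x = n" "length y = n" and ex: "\<exists>!i. i < n \<and> x ! i \<noteq> y ! i"
    using assms by (auto simp: hypercube_edge_iff)
  obtain j where "j < n - k" "drop k x ! j \<noteq> drop k y ! j"
    using assms(2) len nth_equalityI[of "drop k x" "drop k y"] by auto
  then have "k + j < n" "x ! (k + j) \<noteq> y ! (k + j)"
    using len by auto
  with ex have "x ! i = y ! i" if "i < k" for i
    using that by (metis assms(3) less_le_trans not_add_less1)
  then show ?thesis
    using len assms(3) by (intro nth_equalityI) auto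
qed

lemma embedding_hypercube_mono:
  assumes "is_embedding f G (hypercube d)" "d \<le> n"
  shows "\<exists>g. is_embedding g G (hypercube n)"
proof
  show "is_embedding (\<lambda>z. f z @ replicate (n - d) False) G (hypercube n)"
    using assms hypercube_edge_append[of "f _" "f _" d "replicate (n - d) False" "n - d"]
    by (auto simp: is_embedding_def inj_on_def image_subset_iff)
qed

text \<open>Vertex-transitivity of the hypercube, through translation by a fixed vertex.\<close>

lemma embedding_hypercube_translate:
  assumes f: "is_embedding f G (hypercube d)" and "u \<in> verts G" "length p = d"
  obtains g where "is_embedding g G (hypercube d)" "g u = p"
proof -
  \<comment> \<open>\<open>map2 (\<noteq>)\<close> is coordinatewise exclusive or. Adding
    \<open>t\<close> sends \<open>f u\<close> to \<open>p\<close> and preserves the set of positions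
    at which two vertices differ.\<close>
  define t where "t = map2 (\<noteq>) (f u) p"
  define g where "g z = map2 (\<noteq>) t (f z)" for z
  have len: "length (f z) = d" if "z \<in> verts G" for z
    using f that by (auto simp: is_embedding_def)
  have t: "length t = d"
    using len assms by (simp add: t_def)
  have g_nth: "g z ! i \<longleftrightarrow> t ! i \<noteq> f z ! i" if "length (f z) = d" "i < d" for z i
    using that t by (simp add: g_def)
  have g_len: "length (g z) = d" if "length (f z) = d" for z
    using that t by (simp add: g_def)
  have "inj_on g (verts G)"
  proof (rule inj_onI)
    fix a b assume ab: "a \<in> verts G" "b \<in> verts G" "g a = g b"
    then have "f a ! i = f b ! i" if "i < d" for i
      using that g_nth[of a i] g_nth[of b i] len by auto
    then have "f a = f b"
      using ab len by (intro nth_equalityI) auto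
    then show "a = b"
      using f ab by (auto simp: is_embedding_def inj_on_def)
  qed
  moreover have "{g a, g b} \<in> edges (hypercube d)" if "{a, b} \<in> edges G" for a b
  proof -
    have e: "length (f a) = d" "length (f b) = d" "\<exists>!i. i < d \<and> f a ! i \<noteq> f b ! i"
      using f that by (auto simp: is_embedding_def hypercube_edge_iff)
    have "i < d \<and> g a ! i \<noteq> g b ! i \<longleftrightarrow> i < d \<and> f a ! i \<noteq> f b ! i" for i
      using g_nth e by auto
    with e g_len show ?thesis
      by (simp add: hypercube_edge_iff)
  qed
  ultimately have "is_embedding g G (hypercube d)"
    using len g_len by (auto simp: is_embedding_def)
  moreover have "g u = p"
    using assms len g_len g_nth by (intro nth_equalityI) (auto simp: t_def)
  ultimately show ?thesis by (rule that)
qed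

section \<open>Gluing two embeddings across a bridge\<close>

text \<open>The suffixes \<open>s\<close> and \<open>t\<close> select two disjoint copies of
  \<open>Q_d\<close> in \<open>K\<close>, which \<open>K\<close> joins by an edge over
  \<open>p\<close>. After translation both \<open>u\<close> and \<open>v\<close> sit over
  \<open>p\<close>. Taking \<open>A\<close> as the complement of \<open>B\<close>, not as the
  component of \<open>u\<close>, covers all vertices even if \<open>G\<close> is
  disconnected.\<close>

lemma embedding_glue:
  fixes G :: "'a graph" and K :: "bool list graph"
  assumes forest: "forest G" and uv: "{u, v} \<in> edges G"
    and A: "A = {z \<in> verts G. \<not> reachable (delete_edge G {u, v}) v z}"
    and B: "B = {z \<in> verts G. reachable (delete_edge G {u, v}) v z}"
    and f1: "is_embedding f1 (induced_subgraph (delete_edge G {u, v}) A) (hypercube d)"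
    and f2: "is_embedding f2 (induced_subgraph (delete_edge G {u, v}) B) (hypercube d)"
    and p: "length p = d"
    and K_verts: "\<And>x. length x = d \<Longrightarrow> x @ s \<in> verts K \<and> x @ t \<in> verts K"
    and K_edges: "\<And>x y. {x, y} \<in> edges (hypercube d) \<Longrightarrow>
      {x @ s, y @ s} \<in> edges K \<and> {x @ t, y @ t} \<in> edges K"
    and st: "s \<noteq> t" "{p @ s, p @ t} \<in> edges K"
  shows "\<exists>f. is_embedding f G K"
proof -
  let ?D = "delete_edge G {u, v}"
  have simple: "simple_graph G" and bridge: "\<not> reachable ?D u v"
    using forest uv by (auto simp: forest_def)
  have vs: "u \<in> verts G" "v \<in> verts G"
    using simple_graph_edgeD[OF simple uv] by auto
  have u: "u \<in> A"
    using vs bridge by (auto simp: A dest: reachable_sym)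
  have v: "v \<in> B"
    using vs by (auto simp: B reachable_refl)
  have disj: "A \<inter> B = {}" and union: "verts G = A \<union> B"
    by (auto simp: A B)
  obtain g1 where g1: "is_embedding g1 (induced_subgraph ?D A) (hypercube d)" "g1 u = p"
    using embedding_hypercube_translate[OF f1 _ p, of u] u by (auto simp: induced_subgraph_def)
  obtain g2 where g2: "is_embedding g2 (induced_subgraph ?D B) (hypercube d)" "g2 v = p"
    using embedding_hypercube_translate[OF f2 _ p, of v] v by (auto simp: induced_subgraph_def)
  have inj: "inj_on g1 A" "inj_on g2 B"
    and len: "\<And>z. z \<in> A \<Longrightarrow> length (g1 z) = d" "\<And>z. z \<in> B \<Longrightarrow> length (g2 z) = d"
    using g1 g2 by (auto simp: is_embedding_def induced_subgraph_def)
  define F where "F z = (if z \<in> A then g1 z @ s else g2 z @ t)" for z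
  have F_A: "F z = g1 z @ s" if "z \<in> A" for z
    using that by (simp add: F_def)
  have F_B: "F z = g2 z @ t" if "z \<in> B" for z
    using that disj by (auto simp: F_def)
  have "inj_on F (verts G)"
    unfolding union
  proof (rule inj_onI)
    fix a b assume ab: "a \<in> A \<union> B" "b \<in> A \<union> B" and eq: "F a = F b"
    consider "a \<in> A" "b \<in> A" | "a \<in> B" "b \<in> B" | "a \<in> A" "b \<in> B" | "a \<in> B" "b \<in> A"
      using ab by blast
    then show "a = b"
    proof cases
      case 1
      with eq show ?thesis by (simp add: F_A inj_onD[OF inj(1)])
    next
      case 2
      with eq show ?thesis by (simp add: F_B inj_onD[OF inj(2)])
    \<comment> \<open>In the mixed cases the prefixes have equal length \<open>d\<close>, so equal
      images would force \<open>s = t\<close>.\<close>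
    qed (use eq st len in \<open>simp_all add: F_A F_B\<close>)
  qed
  moreover have "F ` verts G \<subseteq> verts K"
    unfolding union using len K_verts by (auto simp: F_A F_B)
  moreover have "{F a, F b} \<in> edges K" if ab: "{a, b} \<in> edges G" for a b
  proof (cases "{a, b} = {u, v}")
    case True
    then have "{F a, F b} = {F u, F v}"
      by (auto simp: doubleton_eq_iff)
    with st u v g1 g2 show ?thesis by (simp add: F_A F_B)
  next
    case False
    then have D: "{a, b} \<in> edges ?D"
      using ab by (simp add: delete_edge_def)
    \<comment> \<open>An edge other than \<open>{u, v}\<close> cannot cross between the two
      sides.\<close>
    then have "reachable ?D v a \<longleftrightarrow> reachable ?D v b"
      using reachable_step[of ?D v a b] reachable_step[of ?D v b a]
      by (auto simp: insert_commute[of b a])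
    moreover have "a \<in> verts G" "b \<in> verts G"
      using simple_graph_edgeD[OF simple ab] by auto
    ultimately have "a \<in> A \<and> b \<in> A \<or> a \<in> B \<and> b \<in> B"
      by (auto simp: A B)
    then show ?thesis
    proof
      assume "a \<in> A \<and> b \<in> A"
      with D g1 K_edges show ?thesis
        by (auto simp: F_A is_embedding_def induced_subgraph_def)
    next
      assume "a \<in> B \<and> b \<in> B"
      with D g2 K_edges show ?thesis
        by (auto simp: F_B is_embedding_def induced_subgraph_def)
    qed
  qed
  ultimately show ?thesis
    by (auto simp: is_embedding_def)
qed

section \<open>Finite forests embed in hypercubes; the cubical dimension is attained\<close>

lemma finite_edges:
  assumes "simple_graph G" "finite (verts G)"
  shows "finite (edges G)"
proof (rule finite_subset)
  show "edges G \<subseteq> Pow (verts G)"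
    using assms(1) by (auto simp: simple_graph_def)
qed (simp add: assms(2))

lemma card_bool_lists: "card {x :: bool list. length x = n} = 2 ^ n"
  using card_lists_length_eq[of "UNIV :: bool set" n] by simp

lemma finite_bool_lists: "finite {x :: bool list. length x = n}"
  using finite_lists_length_eq[of "UNIV :: bool set" n] by simp

text \<open>Induction on the number of edges: delete an edge, embed the remaining forest in
  \<open>Q_d\<close>, restrict to the two sides and glue them in the two halves of the next
  cube.\<close>

lemma forest_embeds_hypercube:
  assumes "forest G" "finite (verts G)"
  shows "\<exists>d>0. \<exists>f. is_embedding f G (hypercube d)"
  using assms
proof (induction "card (edges G)" arbitrary: G)
  case 0
  then have "edges G = {}"
    using finite_edges[of G] by (simp add: forest_def)
  \<comment> \<open>Without edges any injection will do; \<open>Suc\<close> keeps the dimension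
    positive even for the empty graph.\<close>
  moreover let ?d = "Suc (card (verts G))"
  have "card (verts G) < 2 ^ card (verts G)" by (rule less_exp)
  then have "card (verts G) \<le> 2 ^ ?d" by (simp del: less_exp)
  then have "card (verts G) \<le> card {x :: bool list. length x = ?d}"
    unfolding card_bool_lists .
  then obtain f :: "_ \<Rightarrow> bool list"
    where "f ` verts G \<subseteq> {x. length x = ?d}" "inj_on f (verts G)"
    using card_le_inj[OF 0(3) finite_bool_lists] by blast
  ultimately have "is_embedding f G (hypercube ?d)"
    by (auto simp: is_embedding_def)
  then show ?case by blast
next
  case (Suc m)
  have simple: "simple_graph G" and fin: "finite (edges G)"
    using Suc.prems finite_edges by (auto simp: forest_def)
  obtain e where "e \<in> edges G"
    using Suc.hyps(2) by fastforce
  then obtain u v where uv: "{u, v} \<in> edges G"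
    by (metis simple simple_graph_edge_cases)
  let ?D = "delete_edge G {u, v}"
  have "forest ?D"
    using Suc.prems(1) simple_graph_delete_edge[OF simple]
    by (rule forest_subgraph) (auto simp: delete_edge_def)
  moreover have "m = card (edges ?D)" "finite (verts ?D)"
    using Suc.hyps(2) Suc.prems uv fin by (auto simp: delete_edge_def)
  ultimately obtain d f where d: "d > 0" and f: "is_embedding f ?D (hypercube d)"
    using Suc.hyps(1) by blast
  have "\<exists>F. is_embedding F G (hypercube (Suc d))"
  \<comment> \<open>The new last coordinate separates the two halves, and the base point
    \<open>p\<close> is an arbitrary vertex of \<open>Q_d\<close>.\<close>
  proof (rule embedding_glue[OF Suc.prems(1) uv refl refl,
        where d = d and s = "[False]" and t = "[True]" and p = "replicate d False"])
    show "{replicate d False @ [False], replicate d False @ [True]} \<in> edges (hypercube (Suc d))"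
      by (auto simp: hypercube_edge_iff nth_append less_Suc_eq intro!: ex1I[of _ d])
  next
    fix x y assume "{x, y} \<in> edges (hypercube d)"
    then show "{x @ [False], y @ [False]} \<in> edges (hypercube (Suc d)) \<and>
        {x @ [True], y @ [True]} \<in> edges (hypercube (Suc d))"
      using hypercube_edge_append[of x y d "[_]" 1] by simp
  qed (use f in \<open>auto intro!: embedding_restrict simp: delete_edge_def\<close>)
  then show ?case by blast
qed

text \<open>The previous lemma supplies a witness, so \<open>LEAST\<close> in
  \<open>cubical_dim\<close> is a genuine minimum.\<close>

lemma cubical_dim_embedding:
  assumes "forest G" "finite (verts G)"
  shows "cubical_dim G > 0" "\<exists>f. is_embedding f G (hypercube (cubical_dim G))"
proof -
  have simple: "simple_graph G"
    using assms(1) by (simp add: forest_def)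
  obtain d where "0 < d \<and> contains_copy (hypercube d) G"
    using forest_embeds_hypercube[OF assms] contains_copy_iff_embedding[OF simple] by blast
  then have "0 < cubical_dim G \<and> contains_copy (hypercube (cubical_dim G)) G"
    unfolding cubical_dim_def by (rule LeastI)
  then show "cubical_dim G > 0" "\<exists>f. is_embedding f G (hypercube (cubical_dim G))"
    using contains_copy_iff_embedding[OF simple] by blast+
qed

lemma cubical_dim_le:
  assumes "simple_graph G" "is_embedding f G (hypercube d)" "0 < d"
  shows "cubical_dim G \<le> d"
  unfolding cubical_dim_def using assms contains_copy_iff_embedding
  by (intro Least_le) blast


section \<open>The edges of the hypercube in the first directions\<close>

text \<open>For \<open>k \<le> n\<close>, equality of the tails says that the coordinate being
  flipped is among the first \<open>k\<close>. The components are then copies of \<open>Q_k\<close>,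
  one for each tail.\<close>

definition low_cubes :: "nat \<Rightarrow> nat \<Rightarrow> bool list graph" where
  "low_cubes k n = \<lparr>verts = verts (hypercube n),
     edges = {{x, y} | x y. {x, y} \<in> edges (hypercube n) \<and> drop k x = drop k y}\<rparr>"

lemma low_cubes_edge_iff:
  "{x, y} \<in> edges (low_cubes k n) \<longleftrightarrow> {x, y} \<in> edges (hypercube n) \<and> drop k x = drop k y"
  by (auto simp: low_cubes_def doubleton_eq_iff insert_commute)

lemma subgraph_of_low_cubes: "subgraph_of (low_cubes k n) (hypercube n)"
proof -
  have "edges (low_cubes k n) \<subseteq> edges (hypercube n)"
    by (auto simp: low_cubes_def)
  then show ?thesis
    using simple_graph_hypercube[of n]
    by (auto simp: subgraph_of_def simple_graph_def low_cubes_def)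
qed

text \<open>Setting coordinate \<open>i\<close> to \<open>True\<close> matches these strings with
  the remaining ones, so they are half of all.\<close>

lemma card_bool_lists_nth_False:
  assumes "i < n"
  shows "card {x :: bool list. length x = n \<and> \<not> x ! i} = 2 ^ (n - 1)"
proof -
  let ?F = "{x :: bool list. length x = n \<and> \<not> x ! i}"
  let ?T = "{x :: bool list. length x = n \<and> x ! i}"
  have "bij_betw (\<lambda>x. x[i := True]) ?F ?T"
  proof (rule bij_betw_byWitness[where f' = "\<lambda>x. x[i := False]"])
    have "x[i := False] = x" if "\<not> x ! i" for x
      using that list_update_id[of x i] by simp
    then show "\<forall>x\<in>?F. x[i := True, i := False] = x" by simp
    have "x[i := True] = x" if "x ! i" for x
      using that list_update_id[of x i] by simp
    then show "\<forall>x\<in>?T. x[i := False, i := True] = x" by simp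
  qed (use assms in auto)
  then have "card ?F = card ?T" by (rule bij_betw_same_card)
  moreover have "card (?F \<union> ?T) = card ?F + card ?T"
    by (rule card_Un_disjoint) (auto intro: finite_subset[OF _ finite_bool_lists[of n]])
  moreover have "?F \<union> ?T = {x. length x = n}" by auto
  ultimately have "2 * card ?F = 2 ^ n"
    using card_bool_lists[of n] by simp
  with assms show ?thesis
    by (cases n) auto
qed

text \<open>Each edge is encoded once, by its direction \<open>i < k\<close> and its endpoint with
  \<open>False\<close> at \<open>i\<close>. If \<open>n = 0\<close> then \<open>k = 0\<close>, so
  the truncated \<open>n - 1\<close> does no harm.\<close>

lemma card_edges_low_cubes:
  assumes "k \<le> n"
  shows "card (edges (low_cubes k n)) = k * 2 ^ (n - 1)"
proof -
  define X where "X i = {x :: bool list. length x = n \<and> \<not> x ! i}" for i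
  define h where "h = (\<lambda>(i, x :: bool list). {x, x[i := True]})"
  have "inj_on h (Sigma {..<k} X)"
  proof (rule inj_onI, clarify)
    fix i x j y
    assume i: "i < k" "x \<in> X i" and j: "j < k" "y \<in> X j" and eq: "h (i, x) = h (j, y)"
    have len: "length x = n" "length y = n" and nth: "\<not> x ! i" "\<not> y ! j"
      using i j by (auto simp: X_def)
    have cases: "x = y \<and> x[i := True] = y[j := True] \<or> x = y[j := True] \<and> x[i := True] = y"
      using eq by (auto simp: h_def doubleton_eq_iff)
    have ne: "x[i := True] ! i" "y[j := True] ! j"
      using i j len assms by auto
    show "i = j \<and> x = y"
    proof (cases "i = j")
      case True
      with cases nth ne show ?thesis by metis
    next
      case False
      \<comment> \<open>For distinct directions either matching of endpoints gives a contradiction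
        at position \<open>j\<close>, where \<open>y\<close> is \<open>False\<close> and its partner
        \<open>True\<close>.\<close>
      then have "x[i := True] ! j = x ! j" "y[j := True] ! i = y ! i" by auto
      with cases nth ne show ?thesis by metis
    qed
  qed
  moreover have "h ` Sigma {..<k} X = edges (low_cubes k n)"
  proof
    show "h ` Sigma {..<k} X \<subseteq> edges (low_cubes k n)"
    proof clarify
      fix i x assume "i < k" "x \<in> X i"
      then show "h (i, x) \<in> edges (low_cubes k n)"
        using assms
        by (auto simp: h_def X_def low_cubes_edge_iff hypercube_edge_iff nth_list_update
            intro!: ex1I[of _ i])
    qed
  next
    show "edges (low_cubes k n) \<subseteq> h ` Sigma {..<k} X"
    proof
      fix e assume e: "e \<in> edges (low_cubes k n)"
      then obtain x y where xy: "e = {x, y}"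
        by (auto simp: low_cubes_def)
      with e have Q: "{x, y} \<in> edges (hypercube n)" and dr: "drop k x = drop k y"
        by (auto simp: low_cubes_edge_iff)
      then obtain i where len: "length x = n" "length y = n" and i: "i < n" "x ! i \<noteq> y ! i"
        and uniq: "\<And>j. j < n \<Longrightarrow> x ! j \<noteq> y ! j \<Longrightarrow> j = i"
        unfolding hypercube_edge_iff by blast
      have "i < k"
      proof (rule ccontr)
        assume "\<not> i < k"
        then show False
          using i len nth_drop[of k x "i - k"] nth_drop[of k y "i - k"] dr assms by simp
      qed
      have eq: "x ! j = y ! j" if "j < n" "j \<noteq> i" for j
        using that uniq by blast
      have "y ! j = x[i := y ! i] ! j" "x ! j = y[i := x ! i] ! j" if "j < n" for j
        using that len eq[of j] by (cases "j = i"; simp)+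
      then have upd: "y = x[i := y ! i]" "x = y[i := x ! i]"
        using len by (auto intro!: nth_equalityI)
      show "e \<in> h ` Sigma {..<k} X"
      \<comment> \<open>The representative is whichever endpoint has \<open>False\<close> at
        \<open>i\<close>.\<close>
      proof (cases "x ! i")
        case True
        with upd i len \<open>i < k\<close> xy show ?thesis
          by (intro image_eqI[of _ _ "(i, y)"]) (auto simp: h_def X_def)
      next
        case False
        with upd i len \<open>i < k\<close> xy show ?thesis
          by (intro image_eqI[of _ _ "(i, x)"]) (auto simp: h_def X_def)
      qed
    qed
  qed
  ultimately have "card (edges (low_cubes k n)) = card (Sigma {..<k} X)"
    by (metis card_image)
  also have "\<dots> = (\<Sum>i<k. card (X i))"
    by (rule card_SigmaI) (auto simp: X_def intro: finite_subset[OF _ finite_bool_lists[of n]])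
  also have "\<dots> = (\<Sum>i<k. 2 ^ (n - 1))"
    unfolding X_def using assms by (intro sum.cong card_bool_lists_nth_False) auto
  finally show ?thesis by simp
qed

text \<open>Tails agree along edges, hence on all of the connected \<open>G\<close>. The image lies
  in one copy of \<open>Q_k\<close>, where the first \<open>k\<close> coordinates determine a
  vertex.\<close>

lemma embedding_low_cubes_imp_hypercube:
  assumes simple: "simple_graph G" and conn: "graph_connected G" and kn: "k \<le> n"
    and f: "is_embedding f G (low_cubes k n)"
  shows "is_embedding (\<lambda>z. take k (f z)) G (hypercube k)"
proof -
  have edge: "{f a, f b} \<in> edges (hypercube n)" "drop k (f a) = drop k (f b)"
    if "{a, b} \<in> edges G" for a b
    using f that by (auto simp: is_embedding_def low_cubes_edge_iff)
  have const: "drop k (f a) = drop k (f b)" if "reachable G a b" for a b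
    using that unfolding reachable_def
    by (induction rule: rtranclp_induct) (auto dest: edge(2))
  have "inj_on (\<lambda>z. take k (f z)) (verts G)"
  proof (rule inj_onI)
    fix a b assume ab: "a \<in> verts G" "b \<in> verts G" "take k (f a) = take k (f b)"
    then have "drop k (f a) = drop k (f b)"
      using conn const by (auto simp: graph_connected_def)
    with ab(3) have "f a = f b" by (metis append_take_drop_id)
    then show "a = b"
      using f ab by (auto simp: is_embedding_def inj_on_def)
  qed
  moreover have "length (f z) = n" if "z \<in> verts G" for z
    using f that by (auto simp: is_embedding_def low_cubes_def)
  ultimately show ?thesis
    using kn edge by (auto simp: is_embedding_def intro!: hypercube_edge_take)
qed

section \<open>Saturation, using an edge of the tree that attains the minimum\<close>

theorem theorem3:
  fixes T :: "'a graph" and k :: nat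
  assumes "is_tree T"
    and "edges T \<noteq> {}"
    and "k = edge_split_dim T"
    and "k < cubical_dim T"
  shows "\<forall>n \<ge> k. \<exists>H. saturated (hypercube n) T H \<and> card (edges H) = k * 2 ^ (n - 1)"
proof -
  have simple: "simple_graph T" and fin: "finite (verts T)" and conn: "graph_connected T"
    and forest: "forest T"
    using assms(1) by (auto simp: is_tree_def intro: acyclic_imp_forest)
  have "k \<in> (\<lambda>e. Max (cubical_dim ` components (delete_edge T e))) ` edges T"
    unfolding assms(3) edge_split_dim_def
    using assms(2) finite_edges[OF simple fin] by (intro Min_in) auto
  then obtain e where e: "e \<in> edges T" "k = Max (cubical_dim ` components (delete_edge T e))"
    by blast
  then obtain u v where uv: "{u, v} \<in> edges T"
    and k: "k = Max (cubical_dim ` components (delete_edge T {u, v}))"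
    using simple_graph_edge_cases[OF simple] by metis
  let ?D = "delete_edge T {u, v}"
  have vs: "u \<in> verts T" "v \<in> verts T"
    using simple_graph_edgeD[OF simple uv] by auto
  have simpleD: "simple_graph ?D"
    by (rule simple_graph_delete_edge[OF simple])
  \<comment> \<open>Positivity of \<open>k\<close> comes from the convention that cubical dimensions
    are positive; \<open>cubical_dim_le\<close> needs it below.\<close>
  have comp: "0 < k \<and> (\<exists>f. is_embedding f (induced_subgraph ?D {z \<in> verts T. reachable ?D w z}) (hypercube k))"
    if "w \<in> verts T" for w
  proof -
    let ?C = "induced_subgraph ?D {z \<in> verts T. reachable ?D w z}"
    have "?C \<in> components ?D"
      using that by (auto simp: components_def delete_edge_def)
    moreover have "finite (components ?D)"
      using fin by (auto simp: components_def delete_edge_def)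
    ultimately have le: "cubical_dim ?C \<le> k"
      unfolding k by simp
    have "forest ?C"
      using forest simple_graph_induced[OF simpleD]
      by (rule forest_subgraph) (auto simp: induced_subgraph_def delete_edge_def)
    moreover have "finite (verts ?C)"
      using fin by (simp add: induced_subgraph_def)
    ultimately have "0 < cubical_dim ?C" "\<exists>f. is_embedding f ?C (hypercube (cubical_dim ?C))"
      by (rule cubical_dim_embedding)+
    then show ?thesis
      using embedding_hypercube_mono[OF _ le] le less_le_trans by blast
  qed
  \<comment> \<open>Connectedness of \<open>T\<close> puts every vertex on some side and the bridge
    property on only one, so the component of \<open>u\<close> is the complement that gluing
    expects.\<close>
  have "reachable ?D u z \<longleftrightarrow> \<not> reachable ?D v z" if "z \<in> verts T" for z
  proof -
    have "reachable T u z"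
      using conn vs that by (auto simp: graph_connected_def)
    moreover have "\<not> reachable ?D u v"
      using forest uv by (auto simp: forest_def)
    ultimately show ?thesis
      by (meson reachable_delete_edge_cases reachable_sym reachable_trans)
  qed
  then have A_eq: "{z \<in> verts T. reachable ?D u z} = {z \<in> verts T. \<not> reachable ?D v z}"
    by auto
  obtain f1 f2
    where f1: "is_embedding f1 (induced_subgraph ?D {z \<in> verts T. \<not> reachable ?D v z}) (hypercube k)"
      and f2: "is_embedding f2 (induced_subgraph ?D {z \<in> verts T. reachable ?D v z}) (hypercube k)"
    using comp[OF vs(1)] comp[OF vs(2)] unfolding A_eq by blast
  have "saturated (hypercube n) T (low_cubes k n)" if n: "k \<le> n" for n
    unfolding saturated_def
  proof (intro conjI ballI subgraph_of_low_cubes)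
    \<comment> \<open>A copy would embed \<open>T\<close> in \<open>Q_k\<close> and give
      \<open>cubical_dim T \<le> k\<close>.\<close>
    show "\<not> contains_copy (low_cubes k n) T"
      using embedding_low_cubes_imp_hypercube[OF simple conn n] cubical_dim_le[OF simple]
        comp[OF vs(1)] assms(4)
      by (metis contains_copy_iff_embedding[OF simple] not_le)
  next
    fix e assume e: "e \<in> edges (hypercube n) - edges (low_cubes k n)"
    then obtain x y where xy: "e = {x, y}"
      by (auto simp: hypercube_def)
    with e have Q: "{x, y} \<in> edges (hypercube n)" and dr: "drop k x \<noteq> drop k y"
      by (auto simp: low_cubes_edge_iff)
    have len: "length x = n" "length y = n"
      using Q by (auto simp: hypercube_edge_iff)
    have "\<exists>F. is_embedding F T (add_edge (low_cubes k n) e)"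
    \<comment> \<open>The tails of \<open>x\<close> and \<open>y\<close> name the two copies of
      \<open>Q_k\<close>, and their common head is the point over which the new edge runs.\<close>
    proof (rule embedding_glue[OF forest uv refl refl f1 f2,
          where p = "take k x" and s = "drop k x" and t = "drop k y"])
      show "{take k x @ drop k x, take k x @ drop k y} \<in> edges (add_edge (low_cubes k n) e)"
        using hypercube_edge_take_eq[OF Q dr n]
        by (metis add_edge_def append_take_drop_id graph.select_convs(2) insertI1 xy)
    next
      fix a b assume ab: "{a, b} \<in> edges (hypercube k)"
      then have "length a = k" "length b = k"
        by (auto simp: hypercube_edge_iff)
      then have "{a @ s, b @ s} \<in> edges (low_cubes k n)" if "length s = n - k" for s
        using hypercube_edge_append[OF ab that] n by (simp add: low_cubes_edge_iff)
      then show "{a @ drop k x, b @ drop k x} \<in> edges (add_edge (low_cubes k n) e) \<and>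
          {a @ drop k y, b @ drop k y} \<in> edges (add_edge (low_cubes k n) e)"
        using len by (simp add: add_edge_def)
    qed (use len n dr in \<open>auto simp: add_edge_def low_cubes_def\<close>)
    then show "contains_copy (add_edge (low_cubes k n) e) T"
      using contains_copy_iff_embedding[OF simple] by blast
  qed
  then show ?thesis
    using card_edges_low_cubes by blast
qed

end
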